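(* Let $m,n\ge 1$ be integers and let $\delta>0$. Let $\mathbf x\in\mathbb R^n$ be a random vector whose entries are independent standard normal random variables, and let $A\in\mathbb R^{m\times n}$ be a random matrix whose entries are independent standard normal random variables, with $A$ independent of $\mathbf x$. Let the auxiliary information of the adversary be that $\mathbf x$ and $A$ are drawn from these standard normal distributions. Then the random linear transformation $T:\mathbf x\mapsto A\mathbf x$ has $(\epsilon,\delta)$-reconstructive privacy under this auxiliary information for some $$\epsilon<\mathbb P\big(|\mathbf y|<\delta\big),$$ where $\mathbf y=(y_1,\dots,y_{n-1})\in\mathbb R^{n-1}$ has independent entries $y_1,\dots,y_{n-1}\sim\mathcal N(0,1)$. Explicitly, there is a real number $\epsilon<\mathbb P(|\mathbf y|<\delta)$ such that for every (measurable) function $C:\mathbb R^m\to\mathbb R^n$, $$\mathbb P\big(|C(A\mathbf x)-\mathbf x|<\delta\big)<\epsilon ,$$ the probability being over the joint law of $(\mathbf x,A)$.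
   Context: Here $|\cdot|$ denotes the Euclidean norm; for $n=1$, $\mathbf y$ is the unique element of $\mathbb R^0$, with $|\mathbf y|=0$. Definition ($(\epsilon,\delta)$-reconstructive privacy). A (possibly random) data transformation $T$ is said to have $(\epsilon,\delta)$-reconstructive privacy under auxiliary information $a$ if, for every adversary function $C$ (which receives $T(\mathbf x)$ and $a$ as input), $$\mathbb E_{\mathbf x}\Big(\mathbb P\big[\,|C(T(\mathbf x);a)-\mathbf x|<\delta\,\big]\Big)<\epsilon ,$$ where the inner probability is over the randomness of $T$ and the expectation is over the distribution of the raw data $\mathbf x$. In the present setting the adversary observes $A\mathbf x$ and knows the distributions of $\mathbf x$ and $A$, but does not observe $\mathbf x$ or $A$ themselves; since the auxiliary information is fixed, it is absorbed into the function $C$. *)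

theory Defs
  imports "HOL-Probability.Probability"
begin

definition iid_std_normal :: "'w measure \<Rightarrow> 'i set \<Rightarrow> ('i \<Rightarrow> 'w \<Rightarrow> real) \<Rightarrow> bool" where
  "iid_std_normal M I Z \<longleftrightarrow>
     prob_space.indep_vars M (\<lambda>_. borel) Z I \<and>
     (\<forall>i\<in>I. distributed M lborel (Z i) (\<lambda>t. ennreal (std_normal_density t)))"

text \<open>
  The library's \<open>indep_var\<close> requires both variables to have the same value type; this is the
  same notion for variables of different types (a vector and a matrix).
\<close>
definition indep_rv ::
  "'w measure \<Rightarrow> ('w \<Rightarrow> 'a::topological_space) \<Rightarrow> ('w \<Rightarrow> 'b::topological_space) \<Rightarrow> bool" where
  "indep_rv M U V \<longleftrightarrow>
     U \<in> borel_measurable M \<and> V \<in> borel_measurable M \<and>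
     prob_space.indep_set M
       {U -` S \<inter> space M | S. S \<in> sets borel} {V -` S \<inter> space M | S. S \<in> sets borel}"

text \<open>
  \<open>D\<close> is the distribution of the raw data. A random transformation is given by a
  probability space \<open>R\<close> carrying its randomness, drawn independently of the data, and
  a function \<open>T\<close>: the value at data \<open>x\<close> under outcome \<open>r\<close> is \<open>T r x\<close>.
  For jointly measurable \<open>T\<close> the integrand below is a bounded measurable function of \<open>x\<close>,
  so the Bochner integral is the true expectation.
  The adversary \<open>C\<close> receives the transformed data and the auxiliary information \<open>a\<close>. Since
  \<open>a\<close> is one fixed value, no sigma-algebra is put on its type: measurability of \<open>C\<close> is
  required in the observed data only.
\<close>
definition reconstructive_privacy ::
  "'x::real_normed_vector measure \<Rightarrow> 'r measure \<Rightarrow> ('r \<Rightarrow> 'x \<Rightarrow> 'y::topological_space) \<Rightarrow>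
   'aux \<Rightarrow> real \<Rightarrow> real \<Rightarrow> bool" where
  "reconstructive_privacy D R T a \<epsilon> \<delta> \<longleftrightarrow>
     (\<forall>C :: 'y \<Rightarrow> 'aux \<Rightarrow> 'x. (\<lambda>z. C z a) \<in> borel_measurable borel \<longrightarrow>
        (\<integral>x. \<P>(r in R. norm (C (T r x) a - x) < \<delta>) \<partial>D) < \<epsilon>)"

end

theory Submission
  imports Defs
begin

text \<open>
  Given \<open>x\<close>, the vector \<open>A x\<close> is distributed as \<open>|x|\<close> times a standard Gaussian, so the conditional
  density of \<open>x\<close> given \<open>A x = z\<close> is radial. Let \<open>c\<close> be the guess made at \<open>z\<close> and \<open>e\<close> its direction.
  A point \<open>x\<close> with \<open>|c - x| < \<delta>\<close> either lies in the ball of radius \<open>\<delta>\<close> about the origin, or lies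
  outside that ball, in the cylinder of radius \<open>\<delta>\<close> around the axis \<open>e\<close>, and on the side \<open>x \<bullet> e > 0\<close>.
  By the symmetry \<open>x \<mapsto> -x\<close> the one-sided part has at most half the mass of the cylinder minus the
  ball, and that mass does not depend on \<open>e\<close> by rotation invariance. With \<open>p\<close> and \<open>q\<close> the Gaussian
  masses of the ball and of the cylinder minus the ball, every adversary succeeds with probability at
  most \<open>p + q / 2\<close>, whereas \<open>P(|y| < \<delta>) = p + q\<close> and \<open>q > 0\<close>.
\<close>

subsection \<open>Rotation invariance and radial integrals\<close>

lemma nn_integral_lborel_translation:
  fixes f :: "'a::euclidean_space \<Rightarrow> ennreal"
  assumes [measurable]: "f \<in> borel_measurable borel"
  shows "(\<integral>\<^sup>+x. f (x + c) \<partial>lborel) = (\<integral>\<^sup>+x. f x \<partial>lborel)"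
proof -
  have "(\<integral>\<^sup>+x. f x \<partial>lborel) = (\<integral>\<^sup>+x. f x \<partial>distr lborel borel ((+) c))"
    by (simp add: lborel_distr_plus)
  also have "\<dots> = (\<integral>\<^sup>+x. f (x + c) \<partial>lborel)"
    by (subst nn_integral_distr) (auto simp: add.commute)
  finally show ?thesis ..
qed

lemma orthogonal_transformation_measurable:
  fixes T :: "'a::euclidean_space \<Rightarrow> 'a"
  assumes "orthogonal_transformation T"
  shows "T \<in> borel_measurable borel"
  using assms
  by (intro borel_measurable_continuous_onI linear_continuous_on
      linear_conv_bounded_linear[THEN iffD1] orthogonal_transformation_linear)

lemma ball_sets_borel [measurable]: "ball (c::'a::metric_space) r \<in> sets borel"
  by (rule borel_open) simp

text \<open>
  The library's \<open>measure_orthogonal_image\<close> needs a well-ordered index type. Here Fubini and translation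
  invariance give \<open>vol A * vol B = vol A * vol (T -` B)\<close> for the unit ball \<open>A\<close>, which \<open>T\<close> preserves.
\<close>
lemma lborel_distr_orthogonal_transformation:
  fixes T :: "'a::euclidean_space \<Rightarrow> 'a"
  assumes "orthogonal_transformation T"
  shows "distr lborel borel T = lborel"
proof -
  \<comment> \<open>With the sign changed, the double integral below contains the sum
    \<open>y + S x\<close>. Translating \<open>y\<close> by \<open>S x\<close> moves the argument of
    \<open>B\<close> to \<open>y - S x\<close>, and shifting by \<open>y\<close> then leaves
    \<open>- S x = T x\<close>.\<close>
  define S where "S x = - T x" for x
  have S: "orthogonal_transformation S"
    using assms by (simp add: S_def[abs_def] orthogonal_transformation_neg)
  note [measurable] = orthogonal_transformation_measurable[OF S]
  have surj: "\<exists>d. S d = y" for y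
    using orthogonal_transformation_surj[OF S] by (metis surjE)
  have add: "S (x + d) = S x + S d" for x d
    using S by (simp add: orthogonal_transformation_linear linear_add)
  \<comment> \<open>As \<open>S\<close> is linear and onto, \<open>y = S d\<close> for some
    \<open>d\<close>, so adding \<open>y\<close> outside \<open>S\<close> is a translation of the
    integration variable by \<open>d\<close>.\<close>
  have shift: "(\<integral>\<^sup>+x. f (y + S x) \<partial>lborel) = (\<integral>\<^sup>+x. f (S x) \<partial>lborel)"
    if [measurable]: "f \<in> borel_measurable borel" for f :: "'a \<Rightarrow> ennreal" and y
  proof -
    obtain d where d: "S d = y" using surj by blast
    have "(\<integral>\<^sup>+x. f (y + S x) \<partial>lborel) = (\<integral>\<^sup>+x. f (S (x + d)) \<partial>lborel)"
      by (simp add: add d add.commute)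
    also have "\<dots> = (\<integral>\<^sup>+x. f (S x) \<partial>lborel)"
      by (rule nn_integral_lborel_translation) measurable
    finally show ?thesis .
  qed
  show ?thesis
  proof (rule measure_eqI)
    fix B assume "B \<in> sets (distr lborel borel T)"
    then have B[measurable]: "B \<in> sets borel" by simp
    let ?A = "ball (0::'a) 1"
    let ?I = "indicator :: 'a set \<Rightarrow> 'a \<Rightarrow> ennreal"
    \<comment> \<open>\<open>S\<close> preserves norms, so \<open>S x\<close> lies in the unit ball
      exactly when \<open>x\<close> does, and the inner integral is the volume of the ball for every
      \<open>y\<close>.\<close>
    have "emeasure lborel ?A * emeasure lborel B
        = (\<integral>\<^sup>+y. (\<integral>\<^sup>+x. ?I ?A (S x) \<partial>lborel) * ?I B y \<partial>lborel)"
    proof -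
      have "?I ?A (S x) = ?I ?A x" for x
        using orthogonal_transformation_norm[OF S] by (simp add: indicator_def)
      then show ?thesis by (simp add: nn_integral_cmult)
    qed
    also have "\<dots> = (\<integral>\<^sup>+y. (\<integral>\<^sup>+x. ?I ?A (y + S x) * ?I B y \<partial>lborel) \<partial>lborel)"
    proof (rule nn_integral_cong)
      fix y
      have "(\<integral>\<^sup>+x. ?I ?A (y + S x) * ?I B y \<partial>lborel) = (\<integral>\<^sup>+x. ?I ?A (y + S x) \<partial>lborel) * ?I B y"
        by (rule nn_integral_multc) measurable
      also have "(\<integral>\<^sup>+x. ?I ?A (y + S x) \<partial>lborel) = (\<integral>\<^sup>+x. ?I ?A (S x) \<partial>lborel)"
        by (rule shift) measurable
      finally show "(\<integral>\<^sup>+x. ?I ?A (S x) \<partial>lborel) * ?I B y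
          = (\<integral>\<^sup>+x. ?I ?A (y + S x) * ?I B y \<partial>lborel)" ..
    qed
    also have "\<dots> = (\<integral>\<^sup>+x. (\<integral>\<^sup>+y. ?I ?A (y + S x) * ?I B y \<partial>lborel) \<partial>lborel)"
      by (rule lborel_pair.Fubini') measurable
    also have "\<dots> = (\<integral>\<^sup>+x. (\<integral>\<^sup>+y. ?I ?A y * ?I B (y - S x) \<partial>lborel) \<partial>lborel)"
    proof (rule nn_integral_cong)
      fix x
      show "(\<integral>\<^sup>+y. ?I ?A (y + S x) * ?I B y \<partial>lborel)
          = (\<integral>\<^sup>+y. ?I ?A y * ?I B (y - S x) \<partial>lborel)"
        using nn_integral_lborel_translation[of "\<lambda>y. ?I ?A y * ?I B (y - S x)" "S x"] by simp
    qed
    also have "\<dots> = (\<integral>\<^sup>+y. (\<integral>\<^sup>+x. ?I ?A y * ?I B (y - S x) \<partial>lborel) \<partial>lborel)"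
      by (rule lborel_pair.Fubini') measurable
    also have "\<dots> = (\<integral>\<^sup>+y. ?I ?A y * (\<integral>\<^sup>+x. ?I B (- S x) \<partial>lborel) \<partial>lborel)"
    proof (rule nn_integral_cong)
      fix y
      have "(\<integral>\<^sup>+x. ?I B (y - S x) \<partial>lborel) = (\<integral>\<^sup>+x. ?I B (- ((- y) + S x)) \<partial>lborel)"
        by simp
      also have "\<dots> = (\<integral>\<^sup>+x. ?I B (- S x) \<partial>lborel)"
        by (rule shift[of "\<lambda>z. ?I B (- z)"]) measurable
      finally show "(\<integral>\<^sup>+x. ?I ?A y * ?I B (y - S x) \<partial>lborel)
          = ?I ?A y * (\<integral>\<^sup>+x. ?I B (- S x) \<partial>lborel)"
        by (simp add: nn_integral_cmult)
    qed
    also have "\<dots> = emeasure lborel ?A * (\<integral>\<^sup>+x. ?I B (- S x) \<partial>lborel)"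
      by (simp add: nn_integral_multc)
    also have "(\<integral>\<^sup>+x. ?I B (- S x) \<partial>lborel) = emeasure (distr lborel borel T) B"
      using orthogonal_transformation_measurable[OF assms]
      by (simp add: S_def nn_integral_distr flip: nn_integral_indicator)
    finally have "emeasure lborel ?A * emeasure lborel B
        = emeasure lborel ?A * emeasure (distr lborel borel T) B" .
    \<comment> \<open>The volume of the unit ball is finite and nonzero, so it can be
      cancelled.\<close>
    moreover have "emeasure lborel ?A < top"
      using emeasure_lborel_ball_finite[of "0::'a" 1] by simp
    moreover have "emeasure lborel ?A \<noteq> 0"
      using content_ball_pos[of 1 "0::'a"]
      by (auto simp: measure_def)
    ultimately show "emeasure (distr lborel borel T) B = emeasure lborel B"
      by (auto simp: ennreal_mult_cancel_left)
  qed simp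
qed

lemma nn_integral_orthogonal_transformation:
  fixes T :: "'a::euclidean_space \<Rightarrow> 'a" and f :: "'a::euclidean_space \<Rightarrow> ennreal"
  assumes "orthogonal_transformation T" and [measurable]: "f \<in> borel_measurable borel"
  shows "(\<integral>\<^sup>+x. f (T x) \<partial>lborel) = (\<integral>\<^sup>+x. f x \<partial>lborel)"
proof -
  have "(\<integral>\<^sup>+x. f x \<partial>lborel) = (\<integral>\<^sup>+x. f x \<partial>distr lborel borel T)"
    by (simp add: lborel_distr_orthogonal_transformation assms(1))
  also have "\<dots> = (\<integral>\<^sup>+x. f (T x) \<partial>lborel)"
    using orthogonal_transformation_measurable[OF assms(1)] by (subst nn_integral_distr) auto
  finally show ?thesis ..
qed

section \<open>Balls and cylinders under a radial weight\<close>

text \<open>For a unit vector \<open>e\<close> this is the open tube of radius \<open>r\<close>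
  around the whole line spanned by \<open>e\<close>. Its standard Gaussian mass is that of a ball of
  radius \<open>r\<close> in one dimension less.\<close>

definition cylinder :: "'a::real_inner \<Rightarrow> real \<Rightarrow> 'a set" where
  "cylinder e r = {x. norm (x - (x \<bullet> e) *\<^sub>R e) < r}"

lemma open_cylinder: "open (cylinder e r)"
  unfolding cylinder_def by (intro open_Collect_less continuous_intros)

lemma cylinder_measurable [measurable]:
  "cylinder (e::'a::euclidean_space) r \<in> sets borel"
  by (simp add: borel_open open_cylinder)

text \<open>Pythagoras: \<open>x - t *\<^sub>R e\<close> is the orthogonal sum of the component of
  \<open>x\<close> perpendicular to \<open>e\<close> and a vector of length
  \<open>\<bar>x \<bullet> e - t\<bar>\<close> along \<open>e\<close>.\<close>

lemma norm_perp_le: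
  fixes x e :: "'a::real_inner"
  assumes "norm e = 1"
  shows "norm (x - (x \<bullet> e) *\<^sub>R e) \<le> norm (x - t *\<^sub>R e)"
proof -
  have e: "e \<bullet> e = 1" using assms by (simp add: dot_square_norm)
  have "(norm (x - t *\<^sub>R e))\<^sup>2 = (norm (x - (x \<bullet> e) *\<^sub>R e))\<^sup>2 + (x \<bullet> e - t)\<^sup>2"
    unfolding power2_norm_eq_inner
    by (simp add: inner_diff_left inner_diff_right e inner_commute[of e x] power2_eq_square algebra_simps)
  then show ?thesis
    by (metis norm_ge_zero power2_le_imp_le le_add_same_cancel1 zero_le_power2)
qed

lemma ball_subset_cylinder:
  assumes "norm (e::'a::real_inner) = 1"
  shows "ball 0 r \<subseteq> cylinder e r"
proof
  fix x :: 'a assume "x \<in> ball 0 r"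
  then show "x \<in> cylinder e r"
    using norm_perp_le[OF assms, of x 0] by (simp add: cylinder_def)
qed

text \<open>The guess \<open>c\<close> lies on the axis, so the distance of \<open>x\<close> to the
  axis is at most its distance to \<open>c\<close>. If \<open>x\<close> and \<open>e\<close> made an
  angle of at least a right angle, \<open>c\<close> would be no closer to \<open>x\<close> than the
  origin is, hence at distance at least \<open>r\<close>.\<close>

lemma ball_subset_half_cylinder:
  fixes c e :: "'a::real_inner"
  assumes e: "norm e = 1" and c: "c = norm c *\<^sub>R e"
    and x: "norm (c - x) < r" and r: "r \<le> norm x"
  shows "x \<in> cylinder e r" "0 < x \<bullet> e"
proof -
  show "x \<in> cylinder e r"
    using norm_perp_le[OF e, of x "norm c"] x c by (simp add: cylinder_def norm_minus_commute)
  show "0 < x \<bullet> e"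
  proof (rule ccontr)
    assume "\<not> 0 < x \<bullet> e"
    then have "x \<bullet> c \<le> 0"
      by (subst c) (simp add: mult_nonneg_nonpos)
    with inner_ge_zero[of c] have "2 * (x \<bullet> c) \<le> c \<bullet> c" by linarith
    then have "(norm x)\<^sup>2 \<le> (norm (c - x))\<^sup>2"
      unfolding power2_norm_eq_inner
      by (simp add: inner_diff_left inner_diff_right inner_commute[of c x])
    then have "norm x \<le> norm (c - x)" by (rule power2_le_imp_le) simp
    with x r show False by simp
  qed
qed

text \<open>The weight is an arbitrary nonnegative radial function, so that it can later be the
  unnormalised conditional density for any observation. The axis \<open>e\<close> on the right is
  unrelated to \<open>c\<close>, so the bound is the same for all guesses.\<close>

lemma radial_integral_ball_le:
  fixes c e :: "real^'n" and g :: "real \<Rightarrow> ennreal"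
  assumes [measurable]: "g \<in> borel_measurable borel" and e: "norm e = 1"
  shows "(\<integral>\<^sup>+x. g (norm x) * indicator (ball c r) x \<partial>lborel)
    \<le> (\<integral>\<^sup>+x. g (norm x) * (indicator (ball (0::real^'n) r) x + indicator (cylinder e r - ball 0 r) x / 2) \<partial>lborel)"
proof -
  \<comment> \<open>The guess \<open>0\<close> has no direction of its own; there any unit vector
    serves, and \<open>e\<close> is taken.\<close>
  obtain u where u: "norm u = 1" "c = norm c *\<^sub>R u"
  proof (cases "c = 0")
    case True
    with e that show thesis by auto
  next
    case False
    with that[of "c /\<^sub>R norm c"] show thesis by simp
  qed
  define P where "P v = (cylinder v r - ball 0 r) \<inter> {x. 0 < x \<bullet> v}" for v :: "real^'n"
  have [measurable]: "P v \<in> sets borel" for v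
    unfolding P_def by measurable
  \<comment> \<open>Reflection in the origin keeps the radial weight and maps \<open>P u\<close> to
    a disjoint set inside the same symmetric region, so twice the integral over \<open>P u\<close>
    is at most the integral over that region.\<close>
  have "(\<integral>\<^sup>+x. g (norm x) * indicator (P u) x \<partial>lborel)
      = (\<integral>\<^sup>+x. g (norm (- x)) * indicator (P u) (- x) \<partial>lborel)"
    using nn_integral_orthogonal_transformation[of uminus "\<lambda>x::real^'n. g (norm x) * indicator (P u) x"]
    by (simp add: orthogonal_transformation_neg[of "\<lambda>x. x", simplified])
  then have "2 * (\<integral>\<^sup>+x. g (norm x) * indicator (P u) x \<partial>lborel)
      = (\<integral>\<^sup>+x. g (norm x) * indicator (P u) x + g (norm x) * indicator (P u) (- x) \<partial>lborel)"
    by (subst nn_integral_add) (auto simp: mult_2)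
  also have "\<dots> \<le> (\<integral>\<^sup>+x. g (norm x) * indicator (cylinder u r - ball 0 r) x \<partial>lborel)"
  proof (rule nn_integral_mono)
    fix x
    have "norm (- x - (- x \<bullet> u) *\<^sub>R u) = norm (x - (x \<bullet> u) *\<^sub>R u)"
      by (metis minus_diff_minus norm_minus_cancel inner_minus_left scaleR_minus_left)
    then show "g (norm x) * indicator (P u) x + g (norm x) * indicator (P u) (- x)
      \<le> g (norm x) * indicator (cylinder u r - ball 0 r) x"
      by (auto simp: P_def cylinder_def indicator_def)
  qed
  also have "\<dots> = (\<integral>\<^sup>+x. g (norm x) * indicator (cylinder e r - ball 0 r) x \<partial>lborel)"
  proof -
    \<comment> \<open>An orthogonal map taking \<open>e\<close> to \<open>u\<close> preserves norms
      and carries distances from the axis \<open>e\<close> to distances from the axis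
      \<open>u\<close>.\<close>
    obtain T where T: "orthogonal_transformation T" "T e = u"
      using orthogonal_transformation_exists[of e u] e u(1) by auto
    have *: "norm (T x - (T x \<bullet> u) *\<^sub>R u) = norm (x - (x \<bullet> e) *\<^sub>R e)" for x
    proof -
      have "T x \<bullet> u = x \<bullet> e"
        using T by (auto simp: orthogonal_transformation_def)
      then have "T x - (T x \<bullet> u) *\<^sub>R u = T (x - (x \<bullet> e) *\<^sub>R e)"
        using orthogonal_transformation_linear[OF T(1)] T(2)
        by (simp add: linear_diff linear_scale)
      then show ?thesis using orthogonal_transformation_norm[OF T(1)] by simp
    qed
    have "(\<integral>\<^sup>+x. g (norm x) * indicator (cylinder u r - ball 0 r) x \<partial>lborel)
       = (\<integral>\<^sup>+x. g (norm (T x)) * indicator (cylinder u r - ball 0 r) (T x) \<partial>lborel)"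
      by (rule nn_integral_orthogonal_transformation[symmetric, OF T(1)]) measurable
    also have "\<dots> = (\<integral>\<^sup>+x. g (norm x) * indicator (cylinder e r - ball 0 r) x \<partial>lborel)"
      using orthogonal_transformation_norm[OF T(1)] *
      by (simp add: indicator_def cylinder_def)
    finally show ?thesis .
  qed
  finally have "2 * (\<integral>\<^sup>+x. g (norm x) * indicator (P u) x \<partial>lborel) / 2
      \<le> (\<integral>\<^sup>+x. g (norm x) * indicator (cylinder e r - ball 0 r) x \<partial>lborel) / 2"
    by (rule divide_right_mono_ennreal)
  then have half: "(\<integral>\<^sup>+x. g (norm x) * indicator (P u) x \<partial>lborel)
      \<le> (\<integral>\<^sup>+x. g (norm x) * indicator (cylinder e r - ball 0 r) x \<partial>lborel) / 2"
    unfolding mult.commute[of 2] by (subst (asm) ennreal_mult_divide_eq) auto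
  have "(\<integral>\<^sup>+x. g (norm x) * indicator (ball c r) x \<partial>lborel)
      \<le> (\<integral>\<^sup>+x. g (norm x) * indicator (ball (0::real^'n) r) x + g (norm x) * indicator (P u) x \<partial>lborel)"
    using ball_subset_half_cylinder[OF u, of _ r]
    by (intro nn_integral_mono) (auto simp: indicator_def dist_norm P_def)
  also have "\<dots> = (\<integral>\<^sup>+x. g (norm x) * indicator (ball (0::real^'n) r) x \<partial>lborel)
      + (\<integral>\<^sup>+x. g (norm x) * indicator (P u) x \<partial>lborel)"
    by (subst nn_integral_add) auto
  also have "\<dots> \<le> (\<integral>\<^sup>+x. g (norm x) * indicator (ball (0::real^'n) r) x \<partial>lborel)
      + (\<integral>\<^sup>+x. g (norm x) * indicator (cylinder e r - ball 0 r) x \<partial>lborel) / 2"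
    using half by (intro add_left_mono)
  also have "\<dots> = (\<integral>\<^sup>+x. g (norm x) * indicator (ball (0::real^'n) r) x \<partial>lborel)
      + (\<integral>\<^sup>+x. g (norm x) * indicator (cylinder e r - ball 0 r) x / 2 \<partial>lborel)"
    by (subst nn_integral_divide) auto
  also have "\<dots> = (\<integral>\<^sup>+x. g (norm x) * indicator (ball (0::real^'n) r) x
      + g (norm x) * indicator (cylinder e r - ball 0 r) x / 2 \<partial>lborel)"
    by (subst nn_integral_add) auto
  also have "\<dots> = (\<integral>\<^sup>+x. g (norm x) * (indicator (ball (0::real^'n) r) x + indicator (cylinder e r - ball 0 r) x / 2) \<partial>lborel)"
    by (simp only: distrib_left ennreal_times_divide)
  finally show ?thesis .
qed

subsection \<open>Gaussian vectors\<close>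

text \<open>The singletons \<open>{h j}\<close> are disjoint blocks because \<open>h\<close> is
  injective; variables of disjoint blocks are independent, and each block is read off at its only
  coordinate.\<close>

lemma (in prob_space) indep_vars_reindex:
  assumes ind: "indep_vars (\<lambda>_. N) X I" and h: "inj_on h J" "h ` J \<subseteq> I"
  shows "indep_vars (\<lambda>_. N) (\<lambda>j. X (h j)) J"
proof -
  have "indep_vars (\<lambda>j. PiM {h j} (\<lambda>_. N)) (\<lambda>j w. restrict (\<lambda>i. X i w) {h j}) J"
    using h by (intro indep_vars_restrict[OF ind]) (auto simp: disjoint_family_on_def inj_on_def)
  then have "indep_vars (\<lambda>_. N) (\<lambda>j w. (restrict (\<lambda>i. X i w) {h j}) (h j)) J"
    by (rule indep_vars_compose2[where Y="\<lambda>j f. f (h j)"]) measurable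
  then show ?thesis by simp
qed

text \<open>Tonelli over the coordinates; the proof translates products over \<open>Basis\<close>
  into products over the index type.\<close>

lemma nn_integral_lborel_vec_prod:
  fixes f :: "'n::finite \<Rightarrow> real \<Rightarrow> ennreal"
  assumes [measurable]: "\<And>i. f i \<in> borel_measurable borel"
  shows "(\<integral>\<^sup>+x. (\<Prod>i\<in>UNIV. f i (x $ i)) \<partial>(lborel :: (real^'n) measure))
    = (\<Prod>i\<in>UNIV. \<integral>\<^sup>+t. f i t \<partial>lborel)"
proof -
  let ?a = "\<lambda>i::'n. axis i (1::real)"
  have inj: "inj ?a"
    by (auto simp: inj_def axis_eq_axis)
  have Basis: "Basis = range ?a"
    by (auto simp: Basis_vec_def)
  have [simp]: "inv ?a (?a i) = i" for i
    by (rule inv_f_f[OF inj])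
  have "(\<integral>\<^sup>+x. (\<Prod>i\<in>UNIV. f i (x $ i)) \<partial>(lborel :: (real^'n) measure))
     = (\<integral>\<^sup>+x. (\<Prod>b\<in>Basis. f (inv ?a b) (x \<bullet> b)) \<partial>(lborel :: (real^'n) measure))"
    by (subst Basis) (simp add: prod.reindex[OF inj] inner_axis)
  also have "\<dots> = (\<Prod>b\<in>Basis. \<integral>\<^sup>+t. f (inv ?a b) t \<partial>lborel)"
    by (rule nn_integral_lborel_prod) auto
  also have "\<dots> = (\<Prod>i\<in>UNIV. \<integral>\<^sup>+t. f i t \<partial>lborel)"
    by (subst Basis) (simp add: prod.reindex[OF inj])
  finally show ?thesis .
qed

lemma borel_measurable_vec_eq_components:
  fixes X :: "'a \<Rightarrow> real^'n"
  assumes "\<And>i. (\<lambda>w. X w $ i) \<in> borel_measurable M"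
  shows "X \<in> borel_measurable M"
proof (rule borel_measurable_euclidean_space[THEN iffD2], safe)
  fix b :: "real^'n" assume "b \<in> Basis"
  then obtain i where "b = axis i 1" by (auto simp: Basis_vec_def)
  then show "(\<lambda>x. X x \<bullet> b) \<in> borel_measurable M"
    using assms[of i] by (simp add: inner_axis)
qed

text \<open>Both laws give an open box the product of its one-dimensional probabilities, by
  independence on one side and Tonelli on the other. Boxes are stable under intersection and
  generate the Borel sets.\<close>

lemma (in prob_space) distributed_vec:
  fixes X :: "'a \<Rightarrow> real^'n"
  assumes ind: "indep_vars (\<lambda>_. borel) (\<lambda>i w. X w $ i) UNIV"
    and dist: "\<And>i. distributed M lborel (\<lambda>w. X w $ i) (f i)"
  shows "distributed M lborel X (\<lambda>x. \<Prod>i\<in>UNIV. f i (x $ i))"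
proof -
  have [measurable]: "f i \<in> borel_measurable borel" for i
    using distributed_borel_measurable[OF dist, of i] by simp
  have Xi[measurable]: "(\<lambda>w. X w $ i) \<in> borel_measurable M" for i
    using distributed_measurable[OF dist, of i] by simp
  have [measurable]: "X \<in> borel_measurable M"
    by (rule borel_measurable_vec_eq_components) (rule Xi)
  have "distr M borel X = density lborel (\<lambda>x. \<Prod>i\<in>UNIV. f i (x $ i))"
  proof (rule measure_eqI_generator_eq)
    let ?E = "range (\<lambda>(a, b). box a b::(real^'n) set)"
    show "Int_stable ?E"
      by (auto simp: Int_stable_def box_Int_box)
    show "?E \<subseteq> Pow UNIV" "sets (distr M borel X) = sigma_sets UNIV ?E"
      "sets (density lborel (\<lambda>x. \<Prod>i\<in>UNIV. f i (x $ i))) = sigma_sets UNIV ?E"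
      by (simp_all add: borel_eq_box)
    let ?A = "\<lambda>n::nat. box (- (real n *\<^sub>R One)) (real n *\<^sub>R One) :: (real^'n) set"
    show "range ?A \<subseteq> ?E" "(\<Union>i. ?A i) = UNIV"
      unfolding UN_box_eq_UNIV by auto
    show "emeasure (distr M borel X) (?A i) \<noteq> \<infinity>" for i
      by (simp add: emeasure_distr)
    fix B assume "B \<in> ?E"
    then obtain l u where B: "B = box l u" by auto
    have "emeasure (distr M borel X) B = emeasure M (X -` B \<inter> space M)"
      by (simp add: emeasure_distr B)
    also have "X -` B \<inter> space M = (\<Inter>i\<in>UNIV. (\<lambda>w. X w $ i) -` {l$i<..<u$i} \<inter> space M)"
      by (auto simp: B mem_box_cart)
    also have "emeasure M \<dots> = ennreal (\<Prod>i\<in>UNIV. prob ((\<lambda>w. X w $ i) -` {l$i<..<u$i} \<inter> space M))"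
      unfolding emeasure_eq_measure
      by (subst indep_varsD_finite[OF ind]) auto
    also have "\<dots> = (\<Prod>i\<in>UNIV. emeasure M ((\<lambda>w. X w $ i) -` {l$i<..<u$i} \<inter> space M))"
      by (simp add: emeasure_eq_measure prod_ennreal)
    also have "\<dots> = (\<Prod>i\<in>UNIV. \<integral>\<^sup>+t. f i t * indicator {l$i<..<u$i} t \<partial>lborel)"
      by (intro prod.cong refl distributed_emeasure[OF dist]) auto
    also have "\<dots> = (\<integral>\<^sup>+x. (\<Prod>i\<in>UNIV. f i (x $ i) * indicator {l$i<..<u$i} (x $ i)) \<partial>lborel)"
      by (rule nn_integral_lborel_vec_prod[symmetric]) measurable
    also have "\<dots> = (\<integral>\<^sup>+x. (\<Prod>i\<in>UNIV. f i (x $ i)) * indicator B x \<partial>lborel)"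
    proof -
      have "(\<Prod>i\<in>UNIV. indicator {l$i<..<u$i} (x $ i)) = (indicator B x :: ennreal)" for x
        by (auto simp: B indicator_def mem_box_cart prod_zero_iff)
      then show ?thesis by (simp add: prod.distrib)
    qed
    also have "\<dots> = emeasure (density lborel (\<lambda>x. \<Prod>i\<in>UNIV. f i (x $ i))) B"
      by (simp add: emeasure_density B)
    finally show "emeasure (distr M borel X) B
      = emeasure (density lborel (\<lambda>x. \<Prod>i\<in>UNIV. f i (x $ i))) B" .
  qed
  moreover have "distr M borel X = distr M lborel X"
    by (rule distr_cong) auto
  ultimately show ?thesis
    by (simp add: distributed_def)
qed

text \<open>The squares of the coordinates add up in the exponent, so the joint density depends on
  \<open>norm x\<close> alone; this makes the law of the data radial.\<close>

lemma prod_normal_density: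
  fixes x :: "real^'n"
  shows "(\<Prod>i\<in>UNIV. normal_density 0 s (x $ i))
    = (1 / sqrt (2 * pi * s\<^sup>2)) ^ CARD('n) * exp (- (norm x)\<^sup>2 / (2 * s\<^sup>2))"
proof -
  have "(norm x)\<^sup>2 = (\<Sum>i\<in>UNIV. (x $ i)\<^sup>2)"
    by (simp add: norm_vec_def L2_set_def sum_nonneg)
  then have "exp (- (norm x)\<^sup>2 / (2 * s\<^sup>2)) = (\<Prod>i\<in>UNIV. exp (- (x $ i)\<^sup>2 / (2 * s\<^sup>2)))"
    by (simp add: sum_negf sum_divide_distrib flip: exp_sum)
  then show ?thesis
    by (simp only: normal_density_def prod.distrib prod_constant diff_zero)
qed

lemma (in prob_space) distributed_sum_scaled_normal:
  fixes Z :: "'i \<Rightarrow> 'a \<Rightarrow> real"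
  assumes I: "finite I" and ind: "indep_vars (\<lambda>_. borel) Z I"
    and Z: "\<And>i. i \<in> I \<Longrightarrow> distributed M lborel (Z i) std_normal_density"
    and nz: "\<exists>i\<in>I. a i \<noteq> 0"
  shows "distributed M lborel (\<lambda>w. \<Sum>i\<in>I. a i * Z i w) (normal_density 0 (L2_set a I))"
proof -
  \<comment> \<open>A term with coefficient zero is constant and has no density, so the rule for
    sums of independent normal variables is applied to the other terms only.\<close>
  let ?J = "{i\<in>I. a i \<noteq> 0}"
  have "distributed M lborel (\<lambda>w. \<Sum>i\<in>?J. a i * Z i w)
      (normal_density (\<Sum>i\<in>?J. 0) (sqrt (\<Sum>i\<in>?J. \<bar>a i\<bar>\<^sup>2)))"
  proof (rule sum_indep_normal)
    show "indep_vars (\<lambda>i. borel) (\<lambda>i w. a i * Z i w) ?J"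
      by (rule indep_vars_compose2[where Y="\<lambda>i t. a i * t", OF indep_vars_subset[OF ind]]) auto
    show "distributed M lborel (\<lambda>w. a i * Z i w) (normal_density 0 \<bar>a i\<bar>)" if "i \<in> ?J" for i
      using normal_density_affine[OF Z, of i "a i" 0] that by simp
  qed (use I nz in auto)
  moreover have "(\<Sum>i\<in>?J. a i * Z i w) = (\<Sum>i\<in>I. a i * Z i w)" for w
    using I by (intro sum.mono_neutral_left) auto
  moreover have "(\<Sum>i\<in>?J. \<bar>a i\<bar>\<^sup>2) = (\<Sum>i\<in>I. (a i)\<^sup>2)"
    using I by (intro sum.mono_neutral_cong_left) auto
  ultimately show ?thesis by (simp add: L2_set_def)
qed

text \<open>Each entry of the product combines one row of \<open>A\<close> with coefficients
  \<open>x\<close>, hence is normal with standard deviation \<open>norm x\<close>; distinct rows are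
  disjoint blocks, hence independent. At \<open>x = 0\<close> the product is constant and has no
  density.\<close>

lemma (in prob_space) distributed_matrix_vector_mult:
  fixes A :: "'a \<Rightarrow> real^'n^'m" and x :: "real^'n"
  assumes ind: "indep_vars (\<lambda>_. borel) (\<lambda>(i, j) w. A w $ i $ j) UNIV"
    and A: "\<And>i j. distributed M lborel (\<lambda>w. A w $ i $ j) std_normal_density"
    and x: "x \<noteq> 0"
  shows "distributed M lborel (\<lambda>w. A w *v x) (\<lambda>z. \<Prod>i\<in>UNIV. ennreal (normal_density 0 (norm x) (z $ i)))"
proof (rule distributed_vec)
  have comp: "(A w *v x) $ i = (\<Sum>j\<in>UNIV. x $ j * A w $ i $ j)" for w i
    by (simp add: matrix_vector_mult_def mult.commute)
  let ?r = "\<lambda>i::'m. {i} \<times> (UNIV::'n set)"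
  have "indep_vars (\<lambda>i. PiM (?r i) (\<lambda>_. borel))
      (\<lambda>i w. restrict (\<lambda>p. (case p of (i, j) \<Rightarrow> \<lambda>w. A w $ i $ j) w) (?r i)) UNIV"
    by (rule indep_vars_restrict[OF ind]) (auto simp: disjoint_family_on_def)
  then have "indep_vars (\<lambda>_. borel) (\<lambda>i w. \<Sum>j\<in>UNIV. x $ j *
      (restrict (\<lambda>p. (case p of (i, j) \<Rightarrow> \<lambda>w. A w $ i $ j) w) (?r i)) (i, j)) UNIV"
    by (rule indep_vars_compose2[where Y="\<lambda>i f. \<Sum>j\<in>UNIV. x $ j * f (i, j)"]) measurable
  then show "indep_vars (\<lambda>_. borel) (\<lambda>i w. (A w *v x) $ i) UNIV"
    by (simp add: comp)
  fix i
  have "indep_vars (\<lambda>_. borel) (\<lambda>j w. A w $ i $ j) UNIV"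
    using indep_vars_reindex[OF ind, of "Pair i" UNIV] by (simp add: inj_def)
  then have "distributed M lborel (\<lambda>w. \<Sum>j\<in>UNIV. x $ j * A w $ i $ j)
      (normal_density 0 (L2_set (($) x) UNIV))"
    using x A by (intro distributed_sum_scaled_normal) (auto simp: vec_eq_iff)
  then show "distributed M lborel (\<lambda>w. (A w *v x) $ i)
      (\<lambda>t. ennreal (normal_density 0 (norm x) t))"
    by (simp add: comp norm_vec_def L2_set_def)
qed

subsection \<open>The success probability of an adversary\<close>

text \<open>Read \<open>g (norm x)\<close> as the density of the data and \<open>k (norm x)\<close>
  as that of the observation given \<open>x\<close>. Exchanging the integrals fixes
  \<open>z\<close>, hence the guess \<open>C z\<close>, and leaves the radial weight
  \<open>g s * k s z\<close>. After the ball is replaced by a bound free of \<open>z\<close>,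
  exchanging back integrates \<open>k\<close> to 1.\<close>

lemma mixture_ball_le:
  fixes C :: "'b::euclidean_space \<Rightarrow> real^'n" and k :: "real \<Rightarrow> 'b \<Rightarrow> ennreal"
    and e :: "real^'n"
  assumes [measurable]: "g \<in> borel_measurable borel" "C \<in> borel_measurable borel"
    and k[measurable]: "case_prod k \<in> borel_measurable (borel \<Otimes>\<^sub>M borel)"
    and k1: "\<And>s. 0 < s \<Longrightarrow> (\<integral>\<^sup>+z. k s z \<partial>lborel) = 1"
    and e: "norm e = 1"
  shows "(\<integral>\<^sup>+x. g (norm x) * (\<integral>\<^sup>+z. k (norm x) z * indicator (ball (C z) r) x \<partial>lborel) \<partial>lborel)
    \<le> (\<integral>\<^sup>+x. g (norm x) * (indicator (ball 0 r) x + indicator (cylinder e r - ball 0 r) x / 2) \<partial>lborel)"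
    (is "_ \<le> (\<integral>\<^sup>+x. g (norm x) * ?H x \<partial>lborel)")
proof -
  \<comment> \<open>The centre of the ball varies with the point, so joint measurability is obtained
    by writing membership as a comparison of distances.\<close>
  have [measurable]: "(\<lambda>p. indicator (ball (C (f p)) r) (h p) :: ennreal) \<in> borel_measurable L"
    if [measurable]: "f \<in> borel_measurable L" "h \<in> borel_measurable L" for f h and L :: "'l measure"
  proof -
    have "(\<lambda>p. indicator (ball (C (f p)) r) (h p) :: ennreal)
        = (\<lambda>p. if dist (C (f p)) (h p) < r then 1 else 0)"
      by (auto simp: indicator_def)
    then show ?thesis by simp
  qed
  have [measurable]: "(\<lambda>p. k (f p) (h p)) \<in> borel_measurable L"
    if [measurable]: "f \<in> borel_measurable L" "h \<in> borel_measurable L" for f h and L :: "'l measure"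
    using measurable_compose[of "\<lambda>p. (f p, h p)" L "borel \<Otimes>\<^sub>M borel" "case_prod k" borel] by simp
  have "(\<integral>\<^sup>+x. g (norm x) * (\<integral>\<^sup>+z. k (norm x) z * indicator (ball (C z) r) x \<partial>lborel) \<partial>lborel)
      = (\<integral>\<^sup>+x. (\<integral>\<^sup>+z. g (norm x) * k (norm x) z * indicator (ball (C z) r) x \<partial>lborel) \<partial>lborel)"
    by (simp add: nn_integral_cmult mult.assoc)
  also have "\<dots> = (\<integral>\<^sup>+z. (\<integral>\<^sup>+x. g (norm x) * k (norm x) z * indicator (ball (C z) r) x \<partial>lborel) \<partial>lborel)"
    by (rule lborel_pair.Fubini') measurable
  also have "\<dots> \<le> (\<integral>\<^sup>+z. (\<integral>\<^sup>+x. g (norm x) * k (norm x) z * ?H x \<partial>lborel) \<partial>lborel)"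
  proof (rule nn_integral_mono)
    fix z
    show "(\<integral>\<^sup>+x. g (norm x) * k (norm x) z * indicator (ball (C z) r) x \<partial>lborel)
      \<le> (\<integral>\<^sup>+x. g (norm x) * k (norm x) z * ?H x \<partial>lborel)"
      using radial_integral_ball_le[where g="\<lambda>s. g s * k s z" and c="C z" and r=r, OF _ e] by simp
  qed
  also have "\<dots> = (\<integral>\<^sup>+x. (\<integral>\<^sup>+z. g (norm x) * k (norm x) z * ?H x \<partial>lborel) \<partial>lborel)"
    by (rule lborel_pair.Fubini'[symmetric]) measurable
  also have "\<dots> = (\<integral>\<^sup>+x. g (norm x) * ?H x \<partial>lborel)"
  \<comment> \<open>\<open>k s\<close> has total mass 1 only for \<open>s > 0\<close>; the
    exceptional point \<open>x = 0\<close> is a null set.\<close>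
  proof (rule nn_integral_cong_AE)
    have "(\<integral>\<^sup>+z. g (norm x) * k (norm x) z * ?H x \<partial>lborel) = g (norm x) * ?H x" if "x \<noteq> 0" for x
    proof -
      have "(\<integral>\<^sup>+z. g (norm x) * k (norm x) z * ?H x \<partial>lborel)
          = g (norm x) * (\<integral>\<^sup>+z. k (norm x) z \<partial>lborel) * ?H x"
        by (simp add: nn_integral_multc nn_integral_cmult)
      with k1[of "norm x"] that show ?thesis by simp
    qed
    then show "AE x in lborel. (\<integral>\<^sup>+z. g (norm x) * k (norm x) z * ?H x \<partial>lborel) = g (norm x) * ?H x"
      using AE_lborel_singleton[of "0::real^'n"] by auto
  qed
  finally show ?thesis .
qed

section \<open>Joint laws and the comparison with \<open>n - 1\<close> coordinates\<close>

text \<open>Independence is the product rule on measurable rectangles, and these determine a product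
  of probability measures.\<close>

lemma distr_indep_rv:
  assumes "prob_space M" "indep_rv M X A"
  shows "distr M (borel \<Otimes>\<^sub>M borel) (\<lambda>w. (X w, A w)) = distr M borel X \<Otimes>\<^sub>M distr M borel A"
proof -
  interpret prob_space M by fact
  have [measurable]: "X \<in> borel_measurable M" "A \<in> borel_measurable M"
    using assms(2) by (auto simp: indep_rv_def)
  interpret X: prob_space "distr M borel X" by (rule prob_space_distr) simp
  interpret A: prob_space "distr M borel A" by (rule prob_space_distr) simp
  show ?thesis
  proof (rule pair_measure_eqI[symmetric])
    fix S T assume "S \<in> sets (distr M borel X)" "T \<in> sets (distr M borel A)"
    then have [measurable]: "S \<in> sets borel" "T \<in> sets borel" by auto
    have "prob ((X -` S \<inter> space M) \<inter> (A -` T \<inter> space M)) = prob (X -` S \<inter> space M) * prob (A -` T \<inter> space M)"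
      using assms(2) by (intro indep_setD) (auto simp: indep_rv_def)
    moreover have "(\<lambda>w. (X w, A w)) -` (S \<times> T) \<inter> space M = (X -` S \<inter> space M) \<inter> (A -` T \<inter> space M)"
      by auto
    ultimately show "emeasure (distr M borel X) S * emeasure (distr M borel A) T
        = emeasure (distr M (borel \<Otimes>\<^sub>M borel) (\<lambda>w. (X w, A w))) (S \<times> T)"
      by (simp add: emeasure_distr emeasure_eq_measure ennreal_mult'')
  qed (auto intro: X.sigma_finite_measure_axioms A.sigma_finite_measure_axioms)
qed

text \<open>The right-hand side depends on \<open>J\<close> only, which allows families living on
  different probability spaces to be compared.\<close>

lemma (in prob_space) distr_restrict_iid_std_normal:
  assumes "iid_std_normal M J W" "J \<noteq> {}"
  shows "distr M (\<Pi>\<^sub>M j\<in>J. borel) (\<lambda>w. \<lambda>j\<in>J. W j w) = (\<Pi>\<^sub>M j\<in>J. density lborel std_normal_density)"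
proof -
  have W: "distributed M lborel (W j) std_normal_density" if "j \<in> J" for j
    using assms(1) that by (simp add: iid_std_normal_def)
  have rv: "W j \<in> borel_measurable M" if "j \<in> J" for j
    using distributed_measurable[OF W[OF that]] by simp
  have "distr M (\<Pi>\<^sub>M j\<in>J. borel) (\<lambda>w. \<lambda>j\<in>J. W j w) = (\<Pi>\<^sub>M j\<in>J. distr M borel (W j))"
    using indep_vars_iff_distr_eq_PiM'[OF assms(2), of W "\<lambda>_. borel"] rv assms(1)
    by (simp add: iid_std_normal_def)
  also have "\<dots> = (\<Pi>\<^sub>M j\<in>J. density lborel std_normal_density)"
  proof (rule PiM_cong)
    fix j assume "j \<in> J"
    then have "distr M lborel (W j) = density lborel std_normal_density"
      using W by (simp add: distributed_def)
    moreover have "distr M borel (W j) = distr M lborel (W j)"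
      by (rule distr_cong) auto
    ultimately show "distr M borel (W j) = density lborel std_normal_density" by simp
  qed simp
  finally show ?thesis .
qed

lemma (in prob_space) prob_L2_set_iid_std_normal:
  assumes W: "iid_std_normal M J W" and J: "finite J" "J \<noteq> {}"
  shows "\<P>(w in M. L2_set (\<lambda>j. W j w) J < r)
    = measure (\<Pi>\<^sub>M j\<in>J. density lborel std_normal_density)
        {f \<in> space (\<Pi>\<^sub>M j\<in>J. borel). L2_set f J < r}"
proof -
  have [measurable]: "W j \<in> borel_measurable M" if "j \<in> J" for j
    using W that distributed_measurable[of M lborel "W j"] by (auto simp: iid_std_normal_def)
  have [measurable]: "{f \<in> space (\<Pi>\<^sub>M j\<in>J. borel). L2_set f J < r} \<in> sets (\<Pi>\<^sub>M j\<in>J. borel :: real measure)"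
    unfolding L2_set_def by measurable
  have "(\<lambda>w. \<lambda>j\<in>J. W j w) -` {f \<in> space (\<Pi>\<^sub>M j\<in>J. borel). L2_set f J < r} \<inter> space M
      = {w \<in> space M. L2_set (\<lambda>j. W j w) J < r}"
    by (auto simp: space_PiM L2_set_def)
  then show ?thesis
    unfolding distr_restrict_iid_std_normal[OF W J(2), symmetric]
    by (subst measure_distr) auto
qed

text \<open>Reindexing along \<open>h\<close> does not change the Euclidean norm, and then both
  probabilities are the mass of one set under one product measure.\<close>

lemma prob_L2_set_iid_std_normal_eq:
  assumes M: "prob_space M" and N: "prob_space N"
    and Z: "iid_std_normal M I Z" and Y: "iid_std_normal N J Y"
    and h: "bij_betw h J I" and J: "finite J"
  shows "\<P>(w in M. L2_set (\<lambda>i. Z i w) I < r) = \<P>(w in N. L2_set (\<lambda>j. Y j w) J < r)"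
proof -
  have L2: "L2_set f I = L2_set (\<lambda>j. f (h j)) J" for f
    unfolding L2_set_def using sum.reindex_bij_betw[OF h, of "\<lambda>i. (f i)\<^sup>2"] by simp
  have Zh: "iid_std_normal M J (\<lambda>j. Z (h j))"
    using Z h prob_space.indep_vars_reindex[OF M, of _ Z I h J]
    by (auto simp: iid_std_normal_def bij_betw_def)
  show ?thesis
  proof (cases "J = {}")
    \<comment> \<open>This is the case of dimension one: both norms are empty sums, equal to 0, so
      both probabilities are 1 or both are 0, according to the sign of \<open>r\<close>.\<close>
    case True
    then show ?thesis 
      by (cases "0 < r") (simp_all add: L2 prob_space.prob_space[OF M] prob_space.prob_space[OF N])
  next
    case False
    then show ?thesis
      by (simp add: L2 prob_space.prob_L2_set_iid_std_normal[OF M Zh J]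
          prob_space.prob_L2_set_iid_std_normal[OF N Y J])
  qed
qed

text \<open>Removing the component along a coordinate axis leaves the other coordinates; this links
  the cylinder to a vector with one entry less.\<close>

lemma norm_perp_axis:
  fixes x :: "real^'n"
  shows "norm (x - (x \<bullet> axis k 1) *\<^sub>R axis k 1) = L2_set (($) x) (UNIV - {k})"
proof -
  have "(\<Sum>i\<in>UNIV. ((x - (x \<bullet> axis k 1) *\<^sub>R axis k 1) $ i)\<^sup>2) = (\<Sum>i\<in>UNIV - {k}. (x $ i)\<^sup>2)"
    by (rule sum.mono_neutral_cong_right) (auto simp: inner_axis, auto simp: axis_def)
  then show ?thesis by (simp add: norm_vec_def L2_set_def)
qed

text \<open>If the mass were zero, the positive density would force \<open>U\<close> to be a
  Lebesgue null set, which a nonempty open set is not.\<close>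

lemma measure_density_open_pos:
  fixes U :: "'a::euclidean_space set" and f :: "'a \<Rightarrow> ennreal"
  assumes [measurable]: "f \<in> borel_measurable borel" and f: "\<And>x. 0 < f x"
    and U: "open U" "U \<noteq> {}"
  shows "0 < emeasure (density lborel f) U"
proof (rule ccontr)
  have [measurable]: "U \<in> sets borel" using U(1) by (rule borel_open)
  assume "\<not> ?thesis"
  then have "(\<integral>\<^sup>+x. f x * indicator U x \<partial>lborel) = 0"
    by (simp add: emeasure_density)
  then have "AE x in lborel. x \<notin> U"
    using f by (subst (asm) nn_integral_0_iff_AE) (auto simp: indicator_def less_le elim!: eventually_mono split: if_splits)
  then have "emeasure lborel U = 0"
    by (subst (asm) AE_iff_measurable[where N=U]) auto
  then have "negligible U"
    by (simp add: negligible_iff_emeasure0 U(1) borel_open sets_completionI_sets)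
  then show False using open_not_negligible U by blast
qed

lemma (in prob_space) distr_iid_std_normal_vec:
  fixes X :: "'a \<Rightarrow> real^'n"
  assumes "iid_std_normal M UNIV (\<lambda>j w. X w $ j)"
  shows "distr M borel X
    = density lborel (\<lambda>x. ennreal ((1 / sqrt (2 * pi)) ^ CARD('n) * exp (- (norm x)\<^sup>2 / 2)))"
proof -
  have "distributed M lborel X (\<lambda>x. \<Prod>j\<in>UNIV. ennreal (std_normal_density (x $ j)))"
    using assms by (intro distributed_vec) (auto simp: iid_std_normal_def)
  moreover have "distr M borel X = distr M lborel X"
    by (rule distr_cong) auto
  ultimately show ?thesis
    by (simp add: distributed_def prod_ennreal prod_normal_density)
qed

lemma reconstruction_event_measurable:
  fixes C :: "real^'m \<Rightarrow> real^'n"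
  assumes [measurable]: "C \<in> borel_measurable borel"
  shows "{(x, B). norm (C (B *v x) - x) < r} \<in> sets (borel \<Otimes>\<^sub>M (borel :: (real^'n^'m) measure))"
proof -
  have [measurable]: "(\<lambda>p. snd p *v fst p) \<in> borel_measurable (borel \<Otimes>\<^sub>M (borel :: (real^'n^'m) measure))"
    unfolding borel_prod
    by (intro borel_measurable_continuous_onI) (auto simp: matrix_vector_mult_def intro!: continuous_intros)
  have "{p \<in> space (borel \<Otimes>\<^sub>M (borel :: (real^'n^'m) measure)). norm (C (snd p *v fst p) - fst p) < r}
      \<in> sets (borel \<Otimes>\<^sub>M borel)"
    by measurable
  then show ?thesis by (simp add: space_pair_measure case_prod_beta')
qed

section \<open>The bound for a single adversary\<close>

lemma nn_integral_ball_matrix_vector_mult_le: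
  fixes M :: "'w measure" and X :: "'w \<Rightarrow> real^'n" and A :: "'w \<Rightarrow> real^'n^'m"
    and C :: "real^'m \<Rightarrow> real^'n"
  assumes M: "prob_space M"
    and X: "iid_std_normal M UNIV (\<lambda>j w. X w $ j)"
    and A: "iid_std_normal M UNIV (\<lambda>(i, j) w. A w $ i $ j)" "A \<in> borel_measurable M"
    and C[measurable]: "C \<in> borel_measurable borel"
    and e: "norm e = 1"
  shows "(\<integral>\<^sup>+x. emeasure (distr M borel A) {B. norm (C (B *v x) - x) < r} \<partial>distr M borel X)
    \<le> emeasure (distr M borel X) (ball 0 r) + emeasure (distr M borel X) (cylinder e r - ball 0 r) / 2"
proof -
  interpret prob_space M by fact
  \<comment> \<open>\<open>g\<close> is the radial profile of the density of \<open>X\<close>, and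
    \<open>k s\<close> is the density of \<open>A x\<close> for any fixed \<open>x\<close> with
    \<open>norm x = s > 0\<close>.\<close>
  define g where "g s = ennreal ((1 / sqrt (2 * pi)) ^ CARD('n) * exp (- s\<^sup>2 / 2))" for s
  define k where "k s z = (\<Prod>i\<in>UNIV. ennreal (normal_density 0 s (z $ i)))" for s and z :: "real^'m"
  have [measurable]: "g \<in> borel_measurable borel"
    unfolding g_def by measurable
  have [measurable]: "(\<lambda>z. z $ i) \<in> borel_measurable borel" for i :: 'm
    by (intro borel_measurable_continuous_onI continuous_intros)
  have [measurable]: "case_prod k \<in> borel_measurable (borel \<Otimes>\<^sub>M borel)"
    unfolding k_def normal_density_def by measurable
  have k1: "(\<integral>\<^sup>+z. k s z \<partial>lborel) = 1" if "0 < s" for s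
  proof -
    have "(\<integral>\<^sup>+t. ennreal (normal_density 0 s t) \<partial>lborel) = 1"
      using prob_space.emeasure_space_1[OF prob_space_normal_density[OF that, of 0]]
      by (simp add: emeasure_density)
    then show ?thesis
      unfolding k_def by (subst nn_integral_lborel_vec_prod) auto
  qed
  have D: "distr M borel X = density lborel (\<lambda>x. g (norm x))"
    unfolding g_def by (rule distr_iid_std_normal_vec[OF X])
  have Z: "distr M borel (\<lambda>w. A w *v x) = density lborel (k (norm x))" if "x \<noteq> 0" for x
  proof -
    have "distributed M lborel (\<lambda>w. A w *v x) (k (norm x))"
      unfolding k_def using A(1) that
      by (intro distributed_matrix_vector_mult) (auto simp: iid_std_normal_def)
    moreover have "distr M borel (\<lambda>w. A w *v x) = distr M lborel (\<lambda>w. A w *v x)"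
      by (rule distr_cong) auto
    ultimately show ?thesis by (simp add: distributed_def)
  qed
  have mult[measurable]: "(\<lambda>B. B *v x) \<in> borel_measurable borel" for x :: "real^'n"
    by (intro borel_measurable_continuous_onI) (auto simp: matrix_vector_mult_def intro!: continuous_intros)
  have [measurable]: "{z. norm (C z - x) < r} \<in> sets borel" for x
    by measurable
  have km: "k s \<in> borel_measurable borel" for s
    unfolding k_def normal_density_def by measurable
  have "(\<integral>\<^sup>+x. emeasure (distr M borel A) {B. norm (C (B *v x) - x) < r} \<partial>distr M borel X)
      = (\<integral>\<^sup>+x. g (norm x) * emeasure (distr M borel A) {B. norm (C (B *v x) - x) < r} \<partial>lborel)"
  proof -
    interpret R: prob_space "distr M borel A"
      by (rule prob_space_distr) (rule A(2))
    have "(\<lambda>x. emeasure (distr M borel A) (Pair x -` {(x, B). norm (C (B *v x) - x) < r}))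
        \<in> borel_measurable borel"
      \<comment> \<open>Joint measurability of the event makes the probability of its section at
        \<open>x\<close> measurable in \<open>x\<close>, as the density formula requires.\<close>
      by (rule R.measurable_emeasure_Pair) (use reconstruction_event_measurable[OF C, of r] in simp)
    then show ?thesis
      unfolding D by (intro nn_integral_density) (simp_all add: vimage_def)
  qed
  also have "\<dots> = (\<integral>\<^sup>+x. g (norm x) * (\<integral>\<^sup>+z. k (norm x) z * indicator (ball (C z) r) x \<partial>lborel) \<partial>lborel)"
  proof (rule nn_integral_cong_AE)
    have "emeasure (distr M borel A) {B. norm (C (B *v x) - x) < r}
        = (\<integral>\<^sup>+z. k (norm x) z * indicator (ball (C z) r) x \<partial>lborel)" if "x \<noteq> 0" for x
    proof -
      have "emeasure (distr M borel A) {B. norm (C (B *v x) - x) < r}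
          = emeasure (distr (distr M borel A) borel (\<lambda>B. B *v x)) {z. norm (C z - x) < r}"
        by (subst emeasure_distr[of _ "distr M borel A"]) (auto simp: vimage_def)
      also have "distr (distr M borel A) borel (\<lambda>B. B *v x) = density lborel (k (norm x))"
        using A(2) by (subst distr_distr) (auto simp: Z[OF that] comp_def)
      also have "emeasure \<dots> {z. norm (C z - x) < r}
          = (\<integral>\<^sup>+z. k (norm x) z * indicator {z. norm (C z - x) < r} z \<partial>lborel)"
        using km by (subst emeasure_density) auto
      also have "\<dots> = (\<integral>\<^sup>+z. k (norm x) z * indicator (ball (C z) r) x \<partial>lborel)"
        by (intro nn_integral_cong) (auto simp: indicator_def dist_norm)
      finally show ?thesis .
    qed
    then show "AE x in lborel. g (norm x) * emeasure (distr M borel A) {B. norm (C (B *v x) - x) < r}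
        = g (norm x) * (\<integral>\<^sup>+z. k (norm x) z * indicator (ball (C z) r) x \<partial>lborel)"
      using AE_lborel_singleton[of "0::real^'n"] by auto
  qed
  also have "\<dots> \<le> (\<integral>\<^sup>+x. g (norm x) * (indicator (ball 0 r) x + indicator (cylinder e r - ball 0 r) x / 2) \<partial>lborel)"
    using k1 e by (intro mixture_ball_le) auto
  also have "\<dots> = (\<integral>\<^sup>+x. indicator (ball 0 r) x + indicator (cylinder e r - ball 0 r) x / 2 \<partial>distr M borel X)"
    unfolding D by (subst nn_integral_density) auto
  also have "\<dots> = emeasure (distr M borel X) (ball 0 r) + emeasure (distr M borel X) (cylinder e r - ball 0 r) / 2"
    by (subst nn_integral_add) (auto simp: nn_integral_divide)
  finally show ?thesis .
qed

theorem theorem1: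
  fixes M :: "'w measure"
    and X :: "'w \<Rightarrow> real ^ 'n"
    and A :: "'w \<Rightarrow> real ^ 'n ^ 'm"
    and N :: "'v measure"
    and Y :: "nat \<Rightarrow> 'v \<Rightarrow> real"
    and \<delta> :: real
  assumes "\<delta> > 0"
    and "prob_space M"
    and "iid_std_normal M UNIV (\<lambda>j \<omega>. X \<omega> $ j)"
    and "iid_std_normal M UNIV (\<lambda>(i, j) \<omega>. A \<omega> $ i $ j)"
    and "indep_rv M X A"
    and "prob_space N"
    and "iid_std_normal N {..<CARD('n) - 1} Y"
  shows "\<exists>\<epsilon> < \<P>(\<omega> in N. L2_set (\<lambda>i. Y i \<omega>) {..<CARD('n) - 1} < \<delta>).
      reconstructive_privacy (distr M borel X) (distr M borel A) (\<lambda>B x. B *v x)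
        (distr M borel X, distr M borel A) \<epsilon> \<delta> \<and>
      (\<forall>C :: real ^ 'm \<Rightarrow> real ^ 'n. C \<in> borel_measurable borel \<longrightarrow>
        \<P>(\<omega> in M. norm (C (A \<omega> *v X \<omega>) - X \<omega>) < \<delta>) < \<epsilon>)"
proof -
  interpret prob_space M by fact
  let ?D = "distr M borel X" and ?R = "distr M borel A"
  have [measurable]: "X \<in> borel_measurable M" "A \<in> borel_measurable M"
    using assms(5) by (auto simp: indep_rv_def)
  interpret D: prob_space ?D by (rule prob_space_distr) simp
  interpret R: prob_space ?R by (rule prob_space_distr) simp
  \<comment> \<open>Any coordinate may serve as the axis of the cylinder; an index type is
    nonempty.\<close>
  obtain k :: 'n where True by blast
  define e :: "real^'n" where "e = axis k 1"
  have e: "norm e = 1" by (simp add: e_def)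
  define p where "p = measure ?D (ball 0 \<delta>)"
  define q where "q = measure ?D (cylinder e \<delta> - ball 0 \<delta>)"
  have q: "q > 0"
  proof -
    \<comment> \<open>Removing the closed ball leaves an open set, and the point at distance
      \<open>2 * \<delta>\<close> along the axis shows that it is nonempty.\<close>
    let ?U = "cylinder e \<delta> - cball 0 \<delta>"
    have "(2 * \<delta>) *\<^sub>R e \<in> ?U"
      using e assms(1) by (simp add: cylinder_def dot_square_norm)
    then have "0 < emeasure ?D ?U"
      unfolding distr_iid_std_normal_vec[OF assms(3)]
      by (intro measure_density_open_pos open_Diff open_cylinder) auto
    also have "\<dots> \<le> emeasure ?D (cylinder e \<delta> - ball 0 \<delta>)"
      by (rule emeasure_mono) auto
    finally show ?thesis
      by (simp add: q_def D.emeasure_eq_measure)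
  qed
  have pq: "\<P>(\<omega> in N. L2_set (\<lambda>i. Y i \<omega>) {..<CARD('n) - 1} < \<delta>) = p + q"
  proof -
    \<comment> \<open>The entries of \<open>Y\<close> are matched with the coordinates of
      \<open>X\<close> other than \<open>k\<close>; in dimension one both index sets are
      empty.\<close>
    have "card {..<CARD('n) - 1} = card (UNIV - {k})"
      by (simp add: card_Diff_singleton)
    then obtain h where h: "bij_betw h {..<CARD('n) - 1} (UNIV - {k})"
      using finite_same_card_bij[of "{..<CARD('n) - 1}" "UNIV - {k}"] by auto
    have "iid_std_normal M (UNIV - {k}) (\<lambda>j \<omega>. X \<omega> $ j)"
      using assms(3) indep_vars_subset[of "\<lambda>_. borel" _ UNIV "UNIV - {k}"]
      by (auto simp: iid_std_normal_def)
    then have "\<P>(\<omega> in N. L2_set (\<lambda>i. Y i \<omega>) {..<CARD('n) - 1} < \<delta>)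
        = \<P>(\<omega> in M. L2_set (\<lambda>j. X \<omega> $ j) (UNIV - {k}) < \<delta>)"
      using prob_L2_set_iid_std_normal_eq[OF assms(2,6) _ assms(7) h] by simp
    also have "\<dots> = measure ?D (cylinder e \<delta>)"
      unfolding norm_perp_axis[symmetric]
      by (subst measure_distr) (auto simp: e_def cylinder_def intro!: arg_cong[where f=prob])
    also have "\<dots> = p + q"
      using D.finite_measure_Diff[of "cylinder e \<delta>" "ball 0 \<delta>"] ball_subset_cylinder[OF e, of \<delta>]
      by (simp add: p_def q_def)
    finally show ?thesis .
  qed
  define b where "b = p + q / 2"
  have b: "0 \<le> b" "emeasure ?D (ball 0 \<delta>) + emeasure ?D (cylinder e \<delta> - ball 0 \<delta>) / 2 = ennreal b"
    using q by (simp_all add: b_def p_def q_def D.emeasure_eq_measure ennreal_divide_numeral ennreal_plus)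
  have bound: "(\<integral>\<^sup>+x. emeasure ?R {B. norm (C (B *v x) - x) < \<delta>} \<partial>?D) \<le> ennreal b"
    if "C \<in> borel_measurable borel" for C :: "real^'m \<Rightarrow> real^'n"
    using nn_integral_ball_matrix_vector_mult_le[OF assms(2-4) _ that e, of \<delta>] b(2) by simp
  have "(\<integral>x. \<P>(B in ?R. norm (C (B *v x) - x) < \<delta>) \<partial>?D) \<le> b"
    if "C \<in> borel_measurable borel" for C :: "real^'m \<Rightarrow> real^'n"
    \<comment> \<open>A bound on the nonnegative integral passes to the Bochner integral because
      \<open>b\<close> is nonnegative.\<close>
    using bound[OF that] b(1) by (intro integral_real_bounded) (simp_all add: R.emeasure_eq_measure)
  moreover have "\<P>(\<omega> in M. norm (C (A \<omega> *v X \<omega>) - X \<omega>) < \<delta>) \<le> b"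
    if [measurable]: "C \<in> borel_measurable borel" for C :: "real^'m \<Rightarrow> real^'n"
  proof -
    let ?S = "{(x, B). norm (C (B *v x) - x) < \<delta>} :: ((real^'n) \<times> (real^'n^'m)) set"
    have S[measurable]: "?S \<in> sets (borel \<Otimes>\<^sub>M borel)"
      by (rule reconstruction_event_measurable) fact
    have "emeasure M {\<omega> \<in> space M. norm (C (A \<omega> *v X \<omega>) - X \<omega>) < \<delta>}
        = emeasure (distr M (borel \<Otimes>\<^sub>M borel) (\<lambda>\<omega>. (X \<omega>, A \<omega>))) ?S"
      by (subst emeasure_distr) (auto intro!: arg_cong[where f="emeasure M"])
    \<comment> \<open>By independence the joint law is a product, so the joint probability becomes
      the same iterated integral as in \<open>bound\<close>.\<close>
    also have "\<dots> = (\<integral>\<^sup>+x. emeasure ?R (Pair x -` ?S) \<partial>?D)"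
      unfolding distr_indep_rv[OF assms(2,5)]
      by (rule R.emeasure_pair_measure_alt) simp
    also have "\<dots> \<le> ennreal b"
      using bound[OF that] by (simp add: vimage_def)
    finally show ?thesis
      using b(1) by (simp add: emeasure_eq_measure)
  qed
  \<comment> \<open>Success is bounded by \<open>p + q / 2\<close> only non-strictly. Any value
    strictly between this and \<open>p + q\<close> gives both strict inequalities, uniformly in
    \<open>C\<close>; the midpoint is chosen.\<close>
  moreover have "b < p + 3 / 4 * q" "p + 3 / 4 * q < p + q"
    using q by (simp_all add: b_def)
  ultimately show ?thesis
    unfolding pq reconstructive_privacy_def
    by (intro exI[of _ "p + 3 / 4 * q"]) (auto intro: le_less_trans)
qed

end
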